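(* Let $\mu>-1$, $q>-1$, $0<\gamma<1$, and $\gamma<\theta<1$. Then for all $x>0$, $$L_{\mu,q}\le\frac{\int_0^x e^{-\gamma t}t^{q-\mu}I_\mu(t)\,dt}{e^{-\gamma x}x^{q-\mu}I_{\mu+1}(x)}\le M_{\mu,q,\gamma}(\theta).$$ At $\gamma=0$, the best possible upper and lower constants (valid for all $x>0$) for the quotient $$\frac{\int_0^x t^{q-\mu}I_\mu(t)\,dt}{x^{q-\mu}I_{\mu+1}(x)}$$ are respectively $K_{\mu,q}$ and $L_{\mu,q}$.
   Context: $I_\alpha(x)=\sum_{k=0}^{\infty}\frac{(x/2)^{2k+\alpha}}{k!\,\Gamma(k+\alpha+1)}$, $x>0$, is the modified Bessel function of the first kind. For $\mu>-1$, $q>-1$, $0<\gamma<\theta<1$: $K_{\mu,q}=\max\{1,\frac{2(\mu+1)}{q+1}\}$; $L_{\mu,q}=\min\{1,\frac{2(\mu+1)}{q+1}\}$; $X_{\mu,q}(\theta)=\frac{2(\mu+2)\theta}{1-\theta}$ if $q\ge0$, and if $-1<q<0$, $$X_{\mu,q}(\theta)=\max\left\{\frac{2(\mu+2)\theta}{1-\theta},\ \frac{(2\mu+2)\theta-q+\sqrt{\{(2\mu+2)\theta-q\}^2-4(1-\theta)q(2\mu+2)}}{2(1-\theta)}\right\};$$ $\beta_{\mu,q}(\theta)=\frac{X_{\mu,q}(\theta)}{X_{\mu,q}(\theta)+2\mu+2}$; and $M_{\mu,q,\gamma}(\theta)=\max\left\{K_{\mu,q}\exp(\gamma X_{\mu,q}(\theta)),\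 \frac{1}{\beta_{\mu,q}(\theta)(\theta-\gamma)}\right\}$. *)

theory Defs
  imports "HOL-Analysis.Analysis"
begin

text \<open>Modified Bessel function of the first kind of real order. Only arguments \<open>x > 0\<close> are
  meaningful; for \<open>\<alpha> > -1\<close> the Gamma function is evaluated only at positive reals.\<close>
definition bessel_I :: "real \<Rightarrow> real \<Rightarrow> real" where
  "bessel_I \<alpha> x = (\<Sum>k::nat. (x / 2) powr (2 * real k + \<alpha>) / (fact k * Gamma (real k + \<alpha> + 1)))"

definition K_const :: "real \<Rightarrow> real \<Rightarrow> real" where
  "K_const \<mu> q = max 1 (2 * (\<mu> + 1) / (q + 1))"

definition L_const :: "real \<Rightarrow> real \<Rightarrow> real" where
  "L_const \<mu> q = min 1 (2 * (\<mu> + 1) / (q + 1))"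

definition X_const :: "real \<Rightarrow> real \<Rightarrow> real \<Rightarrow> real" where
  "X_const \<mu> q \<theta> =
    (if q \<ge> 0 then 2 * (\<mu> + 2) * \<theta> / (1 - \<theta>)
     else max (2 * (\<mu> + 2) * \<theta> / (1 - \<theta>))
       (((2 * \<mu> + 2) * \<theta> - q
          + sqrt (((2 * \<mu> + 2) * \<theta> - q)\<^sup>2 - 4 * (1 - \<theta>) * q * (2 * \<mu> + 2)))
        / (2 * (1 - \<theta>))))"

definition \<beta>_const :: "real \<Rightarrow> real \<Rightarrow> real \<Rightarrow> real" where
  "\<beta>_const \<mu> q \<theta> = X_const \<mu> q \<theta> / (X_const \<mu> q \<theta> + 2 * \<mu> + 2)"

definition M_const :: "real \<Rightarrow> real \<Rightarrow> real \<Rightarrow> real \<Rightarrow> real" where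
  "M_const \<mu> q \<gamma> \<theta> =
    max (K_const \<mu> q * exp (\<gamma> * X_const \<mu> q \<theta>)) (1 / (\<beta>_const \<mu> q \<theta> * (\<theta> - \<gamma>)))"

text \<open>\<open>C\<close> is the best possible upper (lower) constant for \<open>f\<close> on \<open>(0, \<infinity>)\<close>: it is a bound
  valid for all \<open>x > 0\<close>, and no smaller (larger) constant is.\<close>
definition best_upper_const :: "(real \<Rightarrow> real) \<Rightarrow> real \<Rightarrow> bool" where
  "best_upper_const f C \<longleftrightarrow>
    (\<forall>x>0. f x \<le> C) \<and> (\<forall>C'. (\<forall>x>0. f x \<le> C') \<longrightarrow> C \<le> C')"

definition best_lower_const :: "(real \<Rightarrow> real) \<Rightarrow> real \<Rightarrow> bool" where
  "best_lower_const f c \<longleftrightarrow>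
    (\<forall>x>0. c \<le> f x) \<and> (\<forall>c'. (\<forall>x>0. c' \<le> f x) \<longrightarrow> c' \<le> c)"

end

theory Submission
  imports Defs "HOL-Real_Asymp.Real_Asymp"
begin

text \<open>
  Write \<open>I\<^sub>a(x) = (x/2)\<^sup>a E\<^sub>a(x\<^sup>2/4)\<close> with an entire function \<open>E\<^sub>a\<close> having positive coefficients. Up to the
  factor \<open>2\<^sup>\<mu>\<close>, the quotient compares the integral \<open>F\<close> of \<open>e\<^sup>-\<^sup>\<gamma>\<^sup>t t\<^sup>q E\<^sub>\<mu>\<close> with the explicit function
  \<open>U = e\<^sup>-\<^sup>\<gamma>\<^sup>x x\<^sup>q\<^sup>+\<^sup>1 E\<^sub>\<mu>\<^sub>+\<^sub>1/2\<close>. Both vanish at \<open>0\<close> because \<open>q > -1\<close>, so bounds for \<open>F/U\<close> follow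
  from bounds for \<open>F'/U'\<close>, and with \<open>E\<^sub>a' = E\<^sub>a\<^sub>+\<^sub>1\<close> the latter involves only \<open>E\<^sub>\<mu>\<close>, \<open>E\<^sub>\<mu>\<^sub>+\<^sub>1\<close>, \<open>E\<^sub>\<mu>\<^sub>+\<^sub>2\<close>.

  For \<open>\<gamma> = 0\<close> and \<open>z = x\<^sup>2/4\<close> one has \<open>F'/U' = E\<^sub>\<mu>/((q + 1) E\<^sub>\<mu>\<^sub>+\<^sub>1/2 + z E\<^sub>\<mu>\<^sub>+\<^sub>2)\<close>, and the recurrence
  \<open>E\<^sub>\<mu> = (\<mu> + 1) E\<^sub>\<mu>\<^sub>+\<^sub>1 + z E\<^sub>\<mu>\<^sub>+\<^sub>2\<close> exhibits this as a weighted mean of \<open>2(\<mu> + 1)/(q + 1)\<close> and \<open>1\<close>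
  (\<open>bessel_entire_between_majorant_deriv\<close>). The two numbers are the limits of \<open>F/U\<close> at \<open>0\<close> and at
  infinity (\<open>bessel_quotient_tendsto\<close>), so the larger and the smaller of them are best possible.

  For \<open>\<gamma> > 0\<close> the lower bound follows from \<open>e\<^sup>-\<^sup>\<gamma>\<^sup>t \<ge> e\<^sup>-\<^sup>\<gamma>\<^sup>x\<close> on \<open>[0, x]\<close>. For the upper bound, if \<open>x \<le> X\<close>
  then replacing \<open>e\<^sup>-\<^sup>\<gamma>\<^sup>t\<close> by \<open>1\<close> costs at most the factor \<open>e\<^sup>\<gamma>\<^sup>X\<close>. If \<open>x > X\<close> it suffices to show
  \<open>F' \<le> M U'\<close> on \<open>(X, x)\<close>, which follows from the elementary bound \<open>I\<^sub>a\<^sub>+\<^sub>1/I\<^sub>a \<ge> x/(x + 2a + 2)\<close> for \<open>a = \<mu>\<close>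
  and \<open>a = \<mu> + 1\<close> (\<open>bessel_entire_le_majorant_deriv\<close>). That bound comes from the recurrence and
  \<open>I\<^sub>a\<^sub>+\<^sub>1 \<le> I\<^sub>a\<close> for \<open>a \<ge> 0\<close> (\<open>bessel_entire_order_antimono\<close>).
\<close>

section \<open>The entire factor of the modified Bessel function\<close>

definition bessel_coeff :: "real \<Rightarrow> nat \<Rightarrow> real" where
  "bessel_coeff a k = 1 / (fact k * Gamma (real k + a + 1))"

definition bessel_entire :: "real \<Rightarrow> real \<Rightarrow> real" where
  "bessel_entire a z = (\<Sum>k. bessel_coeff a k * z ^ k)"

lemma bessel_coeff_pos: "a > -1 \<Longrightarrow> bessel_coeff a k > 0"
  by (simp add: bessel_coeff_def)

lemma bessel_coeff_shift_order:
  assumes "a > -1"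
  shows "bessel_coeff a k = (real k + a + 1) * bessel_coeff (a + 1) k"
proof -
  have "Gamma (real k + a + 1 + 1) = (real k + a + 1) * Gamma (real k + a + 1)"
    using assms by (intro Gamma_plus1) (auto dest: nonpos_Ints_nonpos)
  moreover have "real k + a + 1 > 0" using assms by simp
  ultimately show ?thesis
    unfolding bessel_coeff_def by (simp add: add.assoc[of _ a 1, symmetric] add_ac)
qed

lemma bessel_coeff_Suc: "real (Suc k) * bessel_coeff a (Suc k) = bessel_coeff (a + 1) k"
  by (simp add: bessel_coeff_def field_simps del: of_nat_Suc) (simp add: algebra_simps)

lemma summable_bessel_entire:
  assumes "a > -1"
  shows "summable (\<lambda>k. bessel_coeff a k * z ^ k)"
proof (rule summable_ratio_test[where c = "1/2" and N = "nat \<lceil>2 * \<bar>z\<bar>\<rceil> + 1"])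
  fix n assume n: "n \<ge> nat \<lceil>2 * \<bar>z\<bar>\<rceil> + 1"
  define b where "b = bessel_coeff (a + 1) n"
  have b: "b > 0" using assms by (simp add: b_def bessel_coeff_pos)
  have "2 * \<bar>z\<bar> \<le> real n" using n by linarith
  also have "real n * 1 \<le> (real n + a + 1) * real (Suc n)"
    using assms by (intro mult_mono) auto
  finally have "\<bar>z\<bar> * 2 \<le> (real n + a + 1) * real (Suc n)" by simp
  then have "\<bar>z\<bar> / real (Suc n) \<le> (real n + a + 1) / 2"
    by (simp add: divide_simps del: of_nat_Suc)
  then have le: "\<bar>z\<bar> / real (Suc n) * (b * \<bar>z\<bar> ^ n) \<le> (real n + a + 1) / 2 * (b * \<bar>z\<bar> ^ n)"
    using b by (intro mult_right_mono) auto
  have 1: "bessel_coeff a (Suc n) = b / real (Suc n)"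
    using bessel_coeff_Suc[of n a] by (simp add: b_def field_simps del: of_nat_Suc)
  have 2: "bessel_coeff a n = (real n + a + 1) * b"
    using bessel_coeff_shift_order[OF assms] by (simp add: b_def)
  show "norm (bessel_coeff a (Suc n) * z ^ Suc n) \<le> 1/2 * norm (bessel_coeff a n * z ^ n)"
    using le b assms unfolding 1 2
    by (simp add: abs_mult power_abs mult_ac del: of_nat_Suc)
qed simp

lemma DERIV_bessel_entire:
  assumes "a > -1"
  shows "(bessel_entire a has_real_derivative bessel_entire (a + 1) z) (at z)"
proof -
  have "diffs (bessel_coeff a) = bessel_coeff (a + 1)"
    using bessel_coeff_Suc by (intro ext) (simp only: diffs_def of_nat_id)
  then show ?thesis
    using termdiffs_strong_converges_everywhere[OF summable_bessel_entire[OF assms], of z]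
    unfolding bessel_entire_def by simp
qed

lemma isCont_bessel_entire: "a > -1 \<Longrightarrow> isCont (bessel_entire a) z"
  using DERIV_bessel_entire DERIV_isCont by blast

lemma isCont_bessel_entire_half_square:
  assumes "a > -1"
  shows "isCont (\<lambda>x. bessel_entire a ((x / 2)\<^sup>2)) x"
  by (rule isCont_o2[OF _ isCont_bessel_entire[OF assms]]) (intro continuous_intros, simp)

lemma continuous_on_bessel_entire_half_square:
  "a > -1 \<Longrightarrow> continuous_on S (\<lambda>x. bessel_entire a ((x / 2)\<^sup>2))"
  by (simp add: continuous_at_imp_continuous_on isCont_bessel_entire_half_square)

lemma bessel_entire_split_head:
  assumes "a > -1"
  shows "(\<Sum>k. bessel_coeff a (Suc k) * z ^ Suc k) = bessel_entire a z - bessel_coeff a 0"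
  using suminf_split_head[OF summable_bessel_entire[OF assms, of z]]
  by (simp add: bessel_entire_def)

lemma bessel_coeff_0_le_bessel_entire:
  assumes "a > -1" "z \<ge> 0"
  shows "bessel_coeff a 0 \<le> bessel_entire a z"
proof -
  have "0 \<le> bessel_coeff a k * z ^ k" for k
    using bessel_coeff_pos[OF assms(1), of k] assms(2) by simp
  then show ?thesis
    using sum_le_suminf[OF summable_bessel_entire[OF assms(1), of z], of "{0}"]
    by (simp add: bessel_entire_def)
qed

lemma bessel_entire_pos: "a > -1 \<Longrightarrow> z \<ge> 0 \<Longrightarrow> bessel_entire a z > 0"
  using bessel_coeff_0_le_bessel_entire bessel_coeff_pos by (meson less_le_trans)

text \<open>In terms of \<open>I\<close> this is \<open>I\<^sub>a(x) - I\<^sub>a\<^sub>+\<^sub>2(x) = (2(a + 1)/x) I\<^sub>a\<^sub>+\<^sub>1(x)\<close>.\<close>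
lemma bessel_entire_recurrence:
  assumes "a > -1"
  shows "bessel_entire a z = (a + 1) * bessel_entire (a + 1) z + z * bessel_entire (a + 2) z"
proof -
  let ?d = "\<lambda>k. real k * bessel_coeff (a + 1) k * z ^ k"
  have shift: "?d (Suc k) = z * (bessel_coeff (a + 2) k * z ^ k)" for k
    using bessel_coeff_Suc[of k "a + 1"] by (simp add: add.assoc)
  have "(\<lambda>k. ?d (Suc k)) sums (z * bessel_entire (a + 2) z)"
    unfolding shift bessel_entire_def
    using summable_bessel_entire[of "a + 2" z] assms by (intro sums_mult summable_sums) auto
  then have "?d sums (z * bessel_entire (a + 2) z)"
    using sums_Suc_iff[of ?d] by simp
  moreover have "(\<lambda>k. (a + 1) * (bessel_coeff (a + 1) k * z ^ k)) sums
      ((a + 1) * bessel_entire (a + 1) z)"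
    unfolding bessel_entire_def
    using summable_bessel_entire[of "a + 1" z] assms by (intro sums_mult summable_sums) auto
  ultimately have "(\<lambda>k. (a + 1) * (bessel_coeff (a + 1) k * z ^ k) + ?d k) sums
      ((a + 1) * bessel_entire (a + 1) z + z * bessel_entire (a + 2) z)"
    by (rule sums_add[rotated])
  moreover have "(a + 1) * (bessel_coeff (a + 1) k * z ^ k) + ?d k = bessel_coeff a k * z ^ k" for k
    unfolding bessel_coeff_shift_order[OF assms, of k] by (simp add: algebra_simps)
  ultimately show ?thesis
    by (simp add: bessel_entire_def sums_iff)
qed

text \<open>The inequality \<open>I\<^sub>a\<^sub>+\<^sub>1 \<le> I\<^sub>a\<close> for \<open>a \<ge> 0\<close>. The \<open>k\<close>-th term of \<open>I\<^sub>a\<^sub>+\<^sub>1\<close> lies, in its exponent, midway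
  between the terms \<open>k\<close> and \<open>k + 1\<close> of \<open>I\<^sub>a\<close>, and is at most their arithmetic mean by the AM-GM
  inequality in the form \<open>2s \<le> (k + 1) + s\<^sup>2/(k + 1)\<close>.\<close>
lemma bessel_entire_order_antimono:
  assumes "a \<ge> 0" "s \<ge> 0"
  shows "s * bessel_entire (a + 1) (s\<^sup>2) \<le> bessel_entire a (s\<^sup>2)"
proof -
  have a: "a > -1" using assms by simp
  let ?t = "\<lambda>k. bessel_coeff a k * (s\<^sup>2) ^ k"
  have sum_t: "summable ?t" "summable (\<lambda>k. ?t (Suc k))"
    using summable_bessel_entire[OF a, of "s\<^sup>2"] summable_Suc_iff[of ?t] by blast+
  have "s * (bessel_coeff (a + 1) k * (s\<^sup>2) ^ k) \<le> 1/2 * ?t k + 1/2 * ?t (Suc k)" for k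
  proof -
    define b where "b = bessel_coeff (a + 1) k * (s\<^sup>2) ^ k"
    define m where "m = real (Suc k)"
    have b: "b \<ge> 0" using bessel_coeff_pos[of "a + 1" k] assms by (simp add: b_def)
    have m: "m > 0" by (simp add: m_def)
    define n where "n = s\<^sup>2 / m"
    have "0 \<le> (m - s)\<^sup>2" by simp
    then have "2 * s \<le> m + n"
      using m by (simp add: n_def power2_eq_square field_simps)
    then have "s \<le> 1/2 * (m + a) + 1/2 * n" using assms by (simp add: field_simps)
    then have "s * b \<le> (1/2 * (m + a) + 1/2 * n) * b"
      by (rule mult_right_mono[OF _ b])
    also have "\<dots> = 1/2 * ((m + a) * b) + 1/2 * (n * b)"
      by (simp only: distrib_right mult.assoc)
    finally have "s * b \<le> 1/2 * ((m + a) * b) + 1/2 * (n * b)" .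
    moreover have "?t k = (m + a) * b"
      unfolding b_def m_def bessel_coeff_shift_order[OF a, of k] by (simp add: algebra_simps)
    moreover have "?t (Suc k) = n * b"
      using bessel_coeff_Suc[of k a] m unfolding b_def n_def m_def[symmetric] by (simp add: field_simps)
    ultimately show ?thesis unfolding b_def[symmetric] by (simp only:)
  qed
  then have "(\<Sum>k. s * (bessel_coeff (a + 1) k * (s\<^sup>2) ^ k)) \<le> (\<Sum>k. 1/2 * ?t k + 1/2 * ?t (Suc k))"
    using sum_t summable_bessel_entire[of "a + 1" "s\<^sup>2"] a
    by (intro suminf_le summable_add summable_mult) auto
  also have "\<dots> = 1/2 * suminf ?t + 1/2 * (\<Sum>k. ?t (Suc k))"
    by (simp only: suminf_add[OF summable_mult[OF sum_t(1)] summable_mult[OF sum_t(2)], symmetric]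
        suminf_mult[OF sum_t(1)] suminf_mult[OF sum_t(2)])
  also have "\<dots> = 1/2 * bessel_entire a (s\<^sup>2)
      + 1/2 * (bessel_entire a (s\<^sup>2) - bessel_coeff a 0)"
    by (simp only: bessel_entire_split_head[OF a] bessel_entire_def[symmetric])
  also have "\<dots> \<le> bessel_entire a (s\<^sup>2)" using bessel_coeff_pos[OF a, of 0] by (simp add: field_simps)
  finally show ?thesis
    using suminf_mult[OF summable_bessel_entire[of "a + 1" "s\<^sup>2"], of s] a
    by (simp add: bessel_entire_def)
qed

text \<open>With \<open>s = x/2\<close> this is the lower bound \<open>I\<^sub>a\<^sub>+\<^sub>1/I\<^sub>a \<ge> x/(x + 2a + 2)\<close>: divide the recurrence by
  \<open>I\<^sub>a\<^sub>+\<^sub>1\<close> and use \<open>I\<^sub>a\<^sub>+\<^sub>2 \<le> I\<^sub>a\<^sub>+\<^sub>1\<close>.\<close>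
lemma bessel_entire_le_next_order:
  assumes "a > -1" "s \<ge> 0"
  shows "bessel_entire a (s\<^sup>2) \<le> (s + a + 1) * bessel_entire (a + 1) (s\<^sup>2)"
proof -
  have "s * (s * bessel_entire (a + 2) (s\<^sup>2)) \<le> s * bessel_entire (a + 1) (s\<^sup>2)"
    using bessel_entire_order_antimono[of "a + 1" s] assms
    by (intro mult_left_mono) (simp_all add: add.assoc)
  then show ?thesis
    unfolding bessel_entire_recurrence[OF assms(1)] by (simp add: power2_eq_square algebra_simps)
qed

lemma bessel_I_eq_bessel_entire:
  assumes "a > -1" "x > 0"
  shows "bessel_I a x = (x / 2) powr a * bessel_entire a ((x / 2)\<^sup>2)"
proof -
  have "(x / 2) powr (2 * real k + a) / (fact k * Gamma (real k + a + 1))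
      = (x / 2) powr a * (bessel_coeff a k * ((x / 2)\<^sup>2) ^ k)" for k
  proof -
    have "(x / 2) powr (2 * real k + a) = (x / 2) powr a * (x / 2) powr real (2 * k)"
      by (simp add: powr_add)
    also have "(x / 2) powr real (2 * k) = ((x / 2)\<^sup>2) ^ k"
      using assms by (subst powr_realpow) (auto simp: power_mult)
    finally show ?thesis by (simp add: bessel_coeff_def)
  qed
  then show ?thesis
    using suminf_mult[OF summable_bessel_entire[OF assms(1), of "(x/2)\<^sup>2"], of "(x / 2) powr a"]
    by (simp add: bessel_I_def bessel_entire_def)
qed

section \<open>The integral and its comparison function\<close>

text \<open>The numerator and the denominator of the quotient, both multiplied by \<open>2\<^sup>\<mu>\<close>.\<close>
definition bessel_moment :: "real \<Rightarrow> real \<Rightarrow> real \<Rightarrow> real \<Rightarrow> real" where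
  "bessel_moment \<mu> q \<gamma> x =
    integral {0..x} (\<lambda>t. exp (- \<gamma> * t) * t powr q * bessel_entire \<mu> ((t / 2)\<^sup>2))"

definition bessel_majorant :: "real \<Rightarrow> real \<Rightarrow> real \<Rightarrow> real \<Rightarrow> real" where
  "bessel_majorant \<mu> q \<gamma> x =
    exp (- \<gamma> * x) * x powr (q + 1) * bessel_entire (\<mu> + 1) ((x / 2)\<^sup>2) / 2"

lemma bessel_quotient_eq:
  assumes "\<mu> > -1" "x > 0"
  shows "integral {0..x} (\<lambda>t. exp (- \<gamma> * t) * t powr (q - \<mu>) * bessel_I \<mu> t)
      / (exp (- \<gamma> * x) * x powr (q - \<mu>) * bessel_I (\<mu> + 1) x)
    = bessel_moment \<mu> q \<gamma> x / bessel_majorant \<mu> q \<gamma> x"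
proof -
  have pw: "t powr (q - \<mu>) * (t / 2) powr \<mu> = 2 powr (- \<mu>) * t powr q" if "t \<ge> 0" for t :: real
  proof (cases "t = 0")
    case False
    then show ?thesis using that
      by (simp add: powr_divide powr_minus powr_diff field_simps)
  qed simp
  have "exp (- \<gamma> * t) * t powr (q - \<mu>) * bessel_I \<mu> t
      = 2 powr (- \<mu>) * (exp (- \<gamma> * t) * t powr q * bessel_entire \<mu> ((t / 2)\<^sup>2))"
    if "t \<in> {0..x}" for t
  proof (cases "t = 0")
    case False
    then have "t > 0" using that by simp
    then show ?thesis
      using pw[of t] by (simp add: bessel_I_eq_bessel_entire[OF assms(1)] mult_ac)
  qed simp
  then have "integral {0..x} (\<lambda>t. exp (- \<gamma> * t) * t powr (q - \<mu>) * bessel_I \<mu> t)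
      = 2 powr (- \<mu>) * bessel_moment \<mu> q \<gamma> x"
    unfolding bessel_moment_def integral_mult_right[symmetric] by (rule integral_cong)
  moreover have "exp (- \<gamma> * x) * x powr (q - \<mu>) * bessel_I (\<mu> + 1) x
      = 2 powr (- \<mu>) * bessel_majorant \<mu> q \<gamma> x"
  proof -
    have "x powr (q - \<mu>) * (x / 2) powr (\<mu> + 1)
        = (x powr (q - \<mu>) * (x / 2) powr \<mu>) * (x / 2)"
      using assms by (simp add: powr_add)
    also have "\<dots> = 2 powr (- \<mu>) * (x powr (q + 1) / 2)"
      using pw[of x] assms by (simp add: powr_add)
    finally show ?thesis
      using assms by (simp add: bessel_I_eq_bessel_entire bessel_majorant_def mult_ac)
  qed
  ultimately show ?thesis by simp
qed

lemma bessel_majorant_pos: "\<mu> > -1 \<Longrightarrow> x > 0 \<Longrightarrow> bessel_majorant \<mu> q \<gamma> x > 0"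
  by (simp add: bessel_majorant_def bessel_entire_pos)

lemma bessel_moment_integrable:
  assumes "\<mu> > -1" "q > -1"
  shows "(\<lambda>t. exp (- \<gamma> * t) * t powr q * bessel_entire \<mu> ((t / 2)\<^sup>2)) integrable_on {0..x}"
proof (cases "x \<ge> 0")
  case True
  let ?g = "\<lambda>t. exp (- \<gamma> * t) * bessel_entire \<mu> ((t / 2)\<^sup>2)"
  have cont: "continuous_on {0..x} ?g"
    by (intro continuous_intros continuous_on_bessel_entire_half_square assms)
  have "(\<lambda>t. ?g t * t powr q) absolutely_integrable_on {0..x}"
  proof (rule absolutely_integrable_bounded_measurable_product_real)
    show "?g \<in> borel_measurable (lebesgue_on {0..x})"
      using cont by (rule continuous_imp_measurable_on_sets_lebesgue) simp
    show "bounded (?g ` {0..x})"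
      using cont by (intro compact_imp_bounded compact_continuous_image) auto
    show "(\<lambda>t. t powr q) absolutely_integrable_on {0..x}"
      using integrable_on_powr_from_0[OF assms(2) True]
      by (rule nonnegative_absolutely_integrable_1) simp
  qed simp
  then show ?thesis
    using set_lebesgue_integral_eq_integral(1) by (fastforce simp: mult_ac)
next
  case False
  then have "{0..x} = {}" by simp
  then show ?thesis by (metis integrable_on_empty)
qed

lemma continuous_on_bessel_moment:
  assumes "\<mu> > -1" "q > -1"
  shows "continuous_on {0..b} (bessel_moment \<mu> q \<gamma>)"
  unfolding bessel_moment_def
  by (rule indefinite_integral_continuous_1[OF bessel_moment_integrable[OF assms]])

lemma continuous_on_bessel_majorant:
  assumes "\<mu> > -1" "q > -1"
  shows "continuous_on {0..b} (bessel_majorant \<mu> q \<gamma>)"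
  unfolding bessel_majorant_def
proof (intro continuous_on_mult continuous_on_divide continuous_on_bessel_entire_half_square)
  show "continuous_on {0..b} (\<lambda>x. x powr (q + 1))"
    using assms by (intro continuous_on_powr' continuous_intros) auto
qed (use assms in \<open>auto intro!: continuous_intros\<close>)

lemma bessel_moment_0 [simp]: "bessel_moment \<mu> q \<gamma> 0 = 0"
  by (simp add: bessel_moment_def)

lemma bessel_majorant_0 [simp]: "bessel_majorant \<mu> q \<gamma> 0 = 0"
  by (simp add: bessel_majorant_def)

lemma DERIV_bessel_moment:
  assumes "\<mu> > -1" "q > -1" "x > 0"
  shows "(bessel_moment \<mu> q \<gamma> has_real_derivative
      exp (- \<gamma> * x) * x powr q * bessel_entire \<mu> ((x / 2)\<^sup>2)) (at x)"
proof -
  let ?f = "\<lambda>t. exp (- \<gamma> * t) * t powr q * bessel_entire \<mu> ((t / 2)\<^sup>2)"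
  have "isCont ?f x"
    using assms by (intro continuous_intros isCont_bessel_entire_half_square) auto
  then have "((\<lambda>u. integral {0..u} ?f) has_vector_derivative ?f x) (at x within ({0..x + 1} - {}))"
    using assms
    by (intro integral_has_vector_derivative_continuous_at bessel_moment_integrable)
      (auto intro: continuous_at_imp_continuous_at_within)
  moreover have "at x within ({0..x + 1} - {}) = at x"
    using assms by (intro at_within_interior) auto
  ultimately show ?thesis
    unfolding bessel_moment_def[abs_def] by (simp add: has_real_derivative_iff_has_vector_derivative)
qed

lemma DERIV_bessel_majorant:
  assumes "\<mu> > -1" "x > 0"
  shows "(bessel_majorant \<mu> q \<gamma> has_real_derivative
      exp (- \<gamma> * x) * x powr q *
        ((q + 1) / 2 * bessel_entire (\<mu> + 1) ((x / 2)\<^sup>2)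
         + (x / 2)\<^sup>2 * bessel_entire (\<mu> + 2) ((x / 2)\<^sup>2)
         - \<gamma> * (x / 2) * bessel_entire (\<mu> + 1) ((x / 2)\<^sup>2))) (at x)"
proof -
  have d: "((\<lambda>x. bessel_entire (\<mu> + 1) ((x / 2)\<^sup>2)) has_real_derivative
      bessel_entire (\<mu> + 2) ((x / 2)\<^sup>2) * (x / 2)) (at x)"
  proof (rule DERIV_chain2[where f = "bessel_entire (\<mu> + 1)" and g = "\<lambda>x. (x / 2)\<^sup>2"])
    show "(bessel_entire (\<mu> + 1) has_real_derivative bessel_entire (\<mu> + 2) ((x / 2)\<^sup>2))
        (at ((x / 2)\<^sup>2))"
      using DERIV_bessel_entire[of "\<mu> + 1"] assms by (simp add: add.assoc)
  qed (auto intro!: derivative_eq_intros)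
  show ?thesis
    unfolding bessel_majorant_def[abs_def]
    by (rule derivative_eq_intros d refl | use assms in \<open>simp; fail\<close>)+
      (use assms in \<open>simp add: powr_add power2_eq_square field_simps\<close>)
qed

section \<open>The case without exponential factor\<close>

lemma increment_le_of_deriv_le:
  fixes f g :: "real \<Rightarrow> real"
  assumes "a \<le> b" "continuous_on {a..b} f" "continuous_on {a..b} g"
    and "\<And>x. a < x \<Longrightarrow> x < b \<Longrightarrow> (f has_real_derivative f' x) (at x)"
    and "\<And>x. a < x \<Longrightarrow> x < b \<Longrightarrow> (g has_real_derivative g' x) (at x)"
    and "\<And>x. a < x \<Longrightarrow> x < b \<Longrightarrow> f' x \<le> g' x"
  shows "f b - f a \<le> g b - g a"
proof -
  have "g a - f a \<le> g b - f b"
  proof (rule DERIV_nonneg_imp_increasing_open[OF assms(1)])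
    fix x assume "a < x" "x < b"
    then show "\<exists>y. ((\<lambda>x. g x - f x) has_real_derivative y) (at x) \<and> 0 \<le> y"
      using DERIV_diff[OF assms(5) assms(4), of x] assms(6)[of x] by force
  qed (intro continuous_intros assms)
  then show ?thesis by simp
qed

text \<open>By the recurrence both sides are combinations of \<open>E\<^sub>\<mu>\<^sub>+\<^sub>1\<close> and \<open>z E\<^sub>\<mu>\<^sub>+\<^sub>2\<close> with positive coefficients. The
  coefficients of \<open>E\<^sub>\<mu>\<^sub>+\<^sub>1\<close> have the ratio \<open>2(\<mu> + 1)/(q + 1)\<close>, those of \<open>z E\<^sub>\<mu>\<^sub>+\<^sub>2\<close> the ratio \<open>1\<close>.\<close>
lemma bessel_entire_between_majorant_deriv:
  assumes "\<mu> > -1" "q > -1" "z \<ge> 0"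
  defines "D \<equiv> (q + 1) / 2 * bessel_entire (\<mu> + 1) z + z * bessel_entire (\<mu> + 2) z"
  shows "L_const \<mu> q * D \<le> bessel_entire \<mu> z" "bessel_entire \<mu> z \<le> K_const \<mu> q * D"
proof -
  define B where "B = (q + 1) / 2 * bessel_entire (\<mu> + 1) z"
  define C where "C = z * bessel_entire (\<mu> + 2) z"
  define \<kappa> where "\<kappa> = 2 * (\<mu> + 1) / (q + 1)"
  have pos: "B \<ge> 0" "C \<ge> 0"
    using assms bessel_entire_pos[of "\<mu> + 1" z] bessel_entire_pos[of "\<mu> + 2" z]
    by (auto simp: B_def C_def)
  have D: "D = B + C" by (simp add: D_def B_def C_def)
  have A: "bessel_entire \<mu> z = \<kappa> * B + 1 * C"
    using assms by (simp add: bessel_entire_recurrence[of \<mu>] \<kappa>_def B_def C_def)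
  have "L_const \<mu> q = min 1 \<kappa>" "K_const \<mu> q = max 1 \<kappa>"
    by (simp_all only: L_const_def K_const_def \<kappa>_def)
  then have LK: "L_const \<mu> q \<le> \<kappa>" "L_const \<mu> q \<le> 1" "\<kappa> \<le> K_const \<mu> q" "1 \<le> K_const \<mu> q"
    by simp_all
  show "L_const \<mu> q * D \<le> bessel_entire \<mu> z"
    unfolding A D distrib_left by (intro add_mono mult_right_mono pos LK)
  show "bessel_entire \<mu> z \<le> K_const \<mu> q * D"
    unfolding A D distrib_left by (intro add_mono mult_right_mono pos LK)
qed

lemma bessel_moment_bounds_0:
  assumes "\<mu> > -1" "q > -1" "x > 0"
  shows "L_const \<mu> q * bessel_majorant \<mu> q 0 x \<le> bessel_moment \<mu> q 0 x"
    and "bessel_moment \<mu> q 0 x \<le> K_const \<mu> q * bessel_majorant \<mu> q 0 x"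
proof -
  let ?F = "\<lambda>t. t powr q * bessel_entire \<mu> ((t / 2)\<^sup>2)"
  let ?D = "\<lambda>t. t powr q * ((q + 1) / 2 * bessel_entire (\<mu> + 1) ((t / 2)\<^sup>2)
         + (t / 2)\<^sup>2 * bessel_entire (\<mu> + 2) ((t / 2)\<^sup>2))"
  have dF: "(bessel_moment \<mu> q 0 has_real_derivative ?F t) (at t)" if "t > 0" for t
    using DERIV_bessel_moment[OF assms(1,2) that, of 0] by simp
  have dD: "((\<lambda>x. c * bessel_majorant \<mu> q 0 x) has_real_derivative c * ?D t) (at t)"
    if "t > 0" for t c
    using DERIV_cmult[OF DERIV_bessel_majorant[OF assms(1) that, of q 0], of c] by simp
  note bounds = bessel_entire_between_majorant_deriv[OF assms(1,2)]
  have cont: "continuous_on {0..x} (\<lambda>x. c * bessel_majorant \<mu> q 0 x)" for c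
    by (intro continuous_intros continuous_on_bessel_majorant assms)
  have "L_const \<mu> q * bessel_majorant \<mu> q 0 x - L_const \<mu> q * bessel_majorant \<mu> q 0 0
      \<le> bessel_moment \<mu> q 0 x - bessel_moment \<mu> q 0 0"
  proof (rule increment_le_of_deriv_le[OF _ cont continuous_on_bessel_moment dD dF])
    show "L_const \<mu> q * ?D t \<le> ?F t" for t
      using mult_left_mono[OF bounds(1)[of "(t / 2)\<^sup>2"], of "t powr q"] by (simp add: mult_ac)
  qed (use assms in auto)
  then show "L_const \<mu> q * bessel_majorant \<mu> q 0 x \<le> bessel_moment \<mu> q 0 x" by simp
  have "bessel_moment \<mu> q 0 x - bessel_moment \<mu> q 0 0
      \<le> K_const \<mu> q * bessel_majorant \<mu> q 0 x - K_const \<mu> q * bessel_majorant \<mu> q 0 0"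
  proof (rule increment_le_of_deriv_le[OF _ continuous_on_bessel_moment cont dF dD])
    show "?F t \<le> K_const \<mu> q * ?D t" for t
      using mult_left_mono[OF bounds(2)[of "(t / 2)\<^sup>2"], of "t powr q"] by (simp add: mult_ac)
  qed (use assms in auto)
  then show "bessel_moment \<mu> q 0 x \<le> K_const \<mu> q * bessel_majorant \<mu> q 0 x" by simp
qed

lemma tendsto_bessel_entire_0:
  assumes "a > -1"
  shows "((\<lambda>x. bessel_entire a ((x / 2)\<^sup>2)) \<longlongrightarrow> bessel_coeff a 0) (at_right 0)"
proof -
  have "((\<lambda>x. bessel_entire a ((x / 2)\<^sup>2)) \<longlongrightarrow> bessel_entire a 0) (at_right 0)"
    using isCont_bessel_entire_half_square[OF assms, of 0]
    by (auto simp: isCont_def intro: tendsto_mono[OF at_le])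
  then show ?thesis by (simp add: bessel_entire_def)
qed

text \<open>By l'Hopital's rule the limits are those of \<open>E\<^sub>\<mu>/((q + 1) E\<^sub>\<mu>\<^sub>+\<^sub>1/2 + z E\<^sub>\<mu>\<^sub>+\<^sub>2)\<close> with \<open>z = x\<^sup>2/4\<close>. At \<open>0\<close> only
  the constant terms of \<open>E\<^sub>\<mu>\<close> and \<open>E\<^sub>\<mu>\<^sub>+\<^sub>1\<close> survive; at infinity the term \<open>z E\<^sub>\<mu>\<^sub>+\<^sub>2\<close>, common to numerator and
  denominator by the recurrence, dominates.\<close>
lemma bessel_quotient_tendsto:
  assumes "\<mu> > -1" "q > -1"
  shows "((\<lambda>x. bessel_moment \<mu> q 0 x / bessel_majorant \<mu> q 0 x) \<longlongrightarrow> 2 * (\<mu> + 1) / (q + 1))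
      (at_right 0)"
    and "((\<lambda>x. bessel_moment \<mu> q 0 x / bessel_majorant \<mu> q 0 x) \<longlongrightarrow> 1) at_top"
proof -
  define A where "A x = bessel_entire \<mu> ((x / 2)\<^sup>2)" for x
  define B where "B x = bessel_entire (\<mu> + 1) ((x / 2)\<^sup>2)" for x
  define C where "C x = (x / 2)\<^sup>2 * bessel_entire (\<mu> + 2) ((x / 2)\<^sup>2)" for x
  define F where "F x = x powr q * A x" for x
  define D where "D x = x powr q * ((q + 1) / 2 * B x + C x)" for x
  have B: "B x > 0" for x using assms by (simp add: B_def bessel_entire_pos)
  have C: "C x \<ge> 0" for x using assms by (simp add: C_def bessel_entire_pos less_imp_le)
  have sum_pos: "(q + 1) / 2 * B x + C x > 0" for x
    using assms B[of x] C[of x] by (simp add: add_pos_nonneg)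
  have D: "D x > 0" if "x > 0" for x using sum_pos[of x] that by (simp add: D_def)
  have AB: "A x = (\<mu> + 1) * B x + C x" for x
    using bessel_entire_recurrence[OF assms(1)] by (simp add: A_def B_def C_def)
  have quot: "F x / D x = A x / ((q + 1) / 2 * B x + C x)" if "x > 0" for x
    using that by (simp add: F_def D_def)
  have dF: "(bessel_moment \<mu> q 0 has_real_derivative F x) (at x)" if "x > 0" for x
    using DERIV_bessel_moment[OF assms that, of 0] by (simp add: F_def A_def)
  have dD: "(bessel_majorant \<mu> q 0 has_real_derivative D x) (at x)" if "x > 0" for x
    using DERIV_bessel_majorant[OF assms(1) that, of q 0] by (simp add: D_def B_def C_def)
  note pos_at_0 = eventually_at_right_less[of "0 :: real"]
  note pos_at_top = eventually_gt_at_top[of "0 :: real"]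

  show "((\<lambda>x. bessel_moment \<mu> q 0 x / bessel_majorant \<mu> q 0 x) \<longlongrightarrow> 2 * (\<mu> + 1) / (q + 1))
      (at_right 0)"
  proof (rule lhopital_right_0)
    show "(bessel_moment \<mu> q 0 \<longlongrightarrow> 0) (at_right 0)"
      using continuous_on_Icc_at_rightD[OF continuous_on_bessel_moment[OF assms, of 1 0]] by simp
    show "(bessel_majorant \<mu> q 0 \<longlongrightarrow> 0) (at_right 0)"
      using continuous_on_Icc_at_rightD[OF continuous_on_bessel_majorant[OF assms, of 1 0]] by simp
    show "\<forall>\<^sub>F x in at_right 0. bessel_majorant \<mu> q 0 x \<noteq> 0"
      using pos_at_0 by eventually_elim (metis bessel_majorant_pos[OF assms(1)] less_irrefl)
    show "\<forall>\<^sub>F x in at_right 0. D x \<noteq> 0"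
      using pos_at_0 by eventually_elim (metis D less_irrefl)
    show "\<forall>\<^sub>F x in at_right 0. (bessel_moment \<mu> q 0 has_real_derivative F x) (at x)"
      using pos_at_0 by eventually_elim (rule dF)
    show "\<forall>\<^sub>F x in at_right 0. (bessel_majorant \<mu> q 0 has_real_derivative D x) (at x)"
      using pos_at_0 by eventually_elim (rule dD)
    have b: "bessel_coeff (\<mu> + 1) 0 > 0" using assms by (simp add: bessel_coeff_pos)
    have "(C \<longlongrightarrow> (0 / 2)\<^sup>2 * bessel_coeff (\<mu> + 2) 0) (at_right 0)"
      unfolding C_def using assms by (intro tendsto_intros tendsto_bessel_entire_0) auto
    moreover have "(A \<longlongrightarrow> bessel_coeff \<mu> 0) (at_right 0)"
      unfolding A_def using assms by (intro tendsto_bessel_entire_0)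
    moreover have "(B \<longlongrightarrow> bessel_coeff (\<mu> + 1) 0) (at_right 0)"
      unfolding B_def using assms by (intro tendsto_bessel_entire_0) auto
    ultimately have "((\<lambda>x. A x / ((q + 1) / 2 * B x + C x)) \<longlongrightarrow>
        bessel_coeff \<mu> 0 / ((q + 1) / 2 * bessel_coeff (\<mu> + 1) 0 + (0 / 2)\<^sup>2 * bessel_coeff (\<mu> + 2) 0))
        (at_right 0)"
      using b assms by (intro tendsto_intros) auto
    moreover have "bessel_coeff \<mu> 0
        / ((q + 1) / 2 * bessel_coeff (\<mu> + 1) 0 + (0 / 2)\<^sup>2 * bessel_coeff (\<mu> + 2) 0)
        = 2 * (\<mu> + 1) / (q + 1)"
      using b by (simp add: bessel_coeff_shift_order[OF assms(1)])
    ultimately have "((\<lambda>x. A x / ((q + 1) / 2 * B x + C x)) \<longlongrightarrow> 2 * (\<mu> + 1) / (q + 1)) (at_right 0)"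
      by simp
    moreover have "\<forall>\<^sub>F x in at_right 0. A x / ((q + 1) / 2 * B x + C x) = F x / D x"
      using pos_at_0 by eventually_elim (simp add: quot)
    ultimately show "((\<lambda>x. F x / D x) \<longlongrightarrow> 2 * (\<mu> + 1) / (q + 1)) (at_right 0)"
      by (rule Lim_transform_eventually)
  qed

  show "((\<lambda>x. bessel_moment \<mu> q 0 x / bessel_majorant \<mu> q 0 x) \<longlongrightarrow> 1) at_top"
  proof (rule lhospital_at_top_at_top)
    define b where "b = bessel_coeff (\<mu> + 1) 0 / 2"
    have b: "b > 0" using assms by (simp add: b_def bessel_coeff_pos)
    have "filterlim (\<lambda>x. b * x powr (q + 1)) at_top at_top"
      using assms b by real_asymp
    moreover have "\<forall>\<^sub>F x in at_top. b * x powr (q + 1) \<le> bessel_majorant \<mu> q 0 x"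
    proof (intro always_eventually allI)
      show "b * x powr (q + 1) \<le> bessel_majorant \<mu> q 0 x" for x
        using mult_right_mono[OF bessel_coeff_0_le_bessel_entire[of "\<mu> + 1" "(x / 2)\<^sup>2"],
            of "x powr (q + 1) / 2"] assms
        by (simp add: b_def bessel_majorant_def mult_ac)
    qed
    ultimately show "filterlim (bessel_majorant \<mu> q 0) at_top at_top"
      by (rule filterlim_at_top_mono)
    show "\<forall>\<^sub>F x in at_top. D x \<noteq> 0"
      using pos_at_top by eventually_elim (metis D less_irrefl)
    show "\<forall>\<^sub>F x in at_top. (bessel_moment \<mu> q 0 has_real_derivative F x) (at x)"
      using pos_at_top by eventually_elim (rule dF)
    show "\<forall>\<^sub>F x in at_top. (bessel_majorant \<mu> q 0 has_real_derivative D x) (at x)"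
      using pos_at_top by eventually_elim (rule dD)
    \<comment> \<open>The term \<open>C\<close> dominates: \<open>B\<close> exceeds \<open>E\<^sub>\<mu>\<^sub>+\<^sub>2\<close> at most by a factor linear in \<open>x\<close>, while \<open>C\<close> carries \<open>x\<^sup>2\<close>.\<close>
    define c where "c = \<bar>\<mu> + 1 - (q + 1) / 2\<bar>"
    have bound: "\<bar>F x / D x - 1\<bar> \<le> c * ((x / 2 + \<mu> + 2) / (x / 2)\<^sup>2)" if x: "x > 0" for x
    proof -
      let ?S = "(q + 1) / 2 * B x + C x"
      have "F x / D x - 1 = (A x - ?S) / ?S"
        using quot[OF x] sum_pos[of x] by (simp add: diff_divide_distrib)
      also have "A x - ?S = (\<mu> + 1 - (q + 1) / 2) * B x"
        by (simp add: AB algebra_simps)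
      finally have "F x / D x - 1 = (\<mu> + 1 - (q + 1) / 2) * (B x / ?S)" by simp
      then have "\<bar>F x / D x - 1\<bar> = c * (B x / ?S)"
        using B[of x] sum_pos[of x] by (simp only: c_def abs_mult) simp
      moreover have "B x / ?S \<le> (x / 2 + \<mu> + 2) / (x / 2)\<^sup>2"
      proof -
        have "(x / 2)\<^sup>2 * B x \<le> (x / 2)\<^sup>2 * ((x / 2 + \<mu> + 2) * bessel_entire (\<mu> + 2) ((x / 2)\<^sup>2))"
          using bessel_entire_le_next_order[of "\<mu> + 1" "x / 2"] assms x
          by (intro mult_left_mono) (simp_all add: B_def add.assoc)
        also have "\<dots> = (x / 2 + \<mu> + 2) * C x" by (simp add: C_def)
        also have "\<dots> \<le> (x / 2 + \<mu> + 2) * ?S"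
          using assms x B[of x] by (intro mult_left_mono) auto
        finally show ?thesis
          using x sum_pos[of x] by (simp only: divide_le_eq le_divide_eq pos_divide_le_eq
            pos_le_divide_eq zero_less_power half_gt_zero times_divide_eq_left) (simp add: mult_ac)
      qed
      then have "c * (B x / ?S) \<le> c * ((x / 2 + \<mu> + 2) / (x / 2)\<^sup>2)"
        by (rule mult_left_mono) (simp add: c_def)
      ultimately show ?thesis by (simp only:)
    qed
    have "((\<lambda>x. c * ((x / 2 + \<mu> + 2) / (x / 2)\<^sup>2)) \<longlongrightarrow> 0) at_top"
      by real_asymp
    then have "((\<lambda>x. F x / D x - 1) \<longlongrightarrow> 0) at_top"
      by (rule Lim_null_comparison[rotated])
        (use pos_at_top in eventually_elim, use bound in simp)
    then show "((\<lambda>x. F x / D x) \<longlongrightarrow> 1) at_top"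
      by (simp add: LIM_zero_iff)
  qed
qed

lemma bessel_quotient_best_constants:
  assumes "\<mu> > -1" "q > -1"
  shows "best_upper_const (\<lambda>x. bessel_moment \<mu> q 0 x / bessel_majorant \<mu> q 0 x) (K_const \<mu> q)"
    and "best_lower_const (\<lambda>x. bessel_moment \<mu> q 0 x / bessel_majorant \<mu> q 0 x) (L_const \<mu> q)"
proof -
  let ?Q = "\<lambda>x. bessel_moment \<mu> q 0 x / bessel_majorant \<mu> q 0 x"
  note lims = bessel_quotient_tendsto[OF assms]
  have ev: "eventually P (at_right 0)" "eventually P at_top"
    if "\<forall>x>0. P x" for P :: "real \<Rightarrow> bool"
    using eventually_mono[OF eventually_at_right_less[of "0 :: real"], of P]
      eventually_mono[OF eventually_gt_at_top[of "0 :: real"], of P] that by blast+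
  show "best_upper_const ?Q (K_const \<mu> q)"
    unfolding best_upper_const_def
  proof safe
    fix x :: real assume "x > 0"
    then show "?Q x \<le> K_const \<mu> q"
      using bessel_moment_bounds_0(2)[OF assms] bessel_majorant_pos[OF assms(1)]
      by (simp add: pos_divide_le_eq)
  next
    fix C assume "\<forall>x>0. ?Q x \<le> C"
    then show "K_const \<mu> q \<le> C"
      using tendsto_upperbound[OF lims(1) ev(1)] tendsto_upperbound[OF lims(2) ev(2)]
      by (auto simp: K_const_def)
  qed
  show "best_lower_const ?Q (L_const \<mu> q)"
    unfolding best_lower_const_def
  proof safe
    fix x :: real assume "x > 0"
    then show "L_const \<mu> q \<le> ?Q x"
      using bessel_moment_bounds_0(1)[OF assms] bessel_majorant_pos[OF assms(1)]
      by (simp add: pos_le_divide_eq)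
  next
    fix C assume "\<forall>x>0. C \<le> ?Q x"
    then show "C \<le> L_const \<mu> q"
      using tendsto_lowerbound[OF lims(1) ev(1)] tendsto_lowerbound[OF lims(2) ev(2)]
      by (auto simp: L_const_def)
  qed
qed

section \<open>The case with exponential factor\<close>

lemma bessel_majorant_eq_exp_times:
  "bessel_majorant \<mu> q \<gamma> x = exp (- \<gamma> * x) * bessel_majorant \<mu> q 0 x"
  by (simp add: bessel_majorant_def)

text \<open>On \<open>[0, x]\<close> the factor \<open>e\<^sup>-\<^sup>\<gamma>\<^sup>t\<close> lies between \<open>e\<^sup>-\<^sup>\<gamma>\<^sup>x\<close> and \<open>1\<close>.\<close>
lemma bessel_moment_exp_bounds:
  assumes "\<mu> > -1" "q > -1" "\<gamma> \<ge> 0"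
  shows "exp (- \<gamma> * x) * bessel_moment \<mu> q 0 x \<le> bessel_moment \<mu> q \<gamma> x"
    and "bessel_moment \<mu> q \<gamma> x \<le> bessel_moment \<mu> q 0 x"
proof -
  let ?f = "\<lambda>\<gamma> t. exp (- \<gamma> * t) * t powr q * bessel_entire \<mu> ((t / 2)\<^sup>2)"
  have int: "?f \<gamma> integrable_on {0..x}" for \<gamma>
    by (rule bessel_moment_integrable[OF assms(1,2)])
  have nonneg: "0 \<le> t powr q * bessel_entire \<mu> ((t / 2)\<^sup>2)" for t
    using bessel_entire_pos[OF assms(1), of "(t / 2)\<^sup>2"] by simp
  have "integral {0..x} (\<lambda>t. exp (- \<gamma> * x) * ?f 0 t) \<le> integral {0..x} (?f \<gamma>)"
  proof (intro integral_le integrable_on_mult_right int)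
    fix t assume "t \<in> {0..x}"
    then have "exp (- \<gamma> * x) \<le> exp (- \<gamma> * t)" using assms by (simp add: mult_left_mono)
    from mult_right_mono[OF this nonneg[of t]]
    show "exp (- \<gamma> * x) * ?f 0 t \<le> ?f \<gamma> t" by (simp add: mult_ac)
  qed
  then show "exp (- \<gamma> * x) * bessel_moment \<mu> q 0 x \<le> bessel_moment \<mu> q \<gamma> x"
    by (simp add: bessel_moment_def)
  have "integral {0..x} (?f \<gamma>) \<le> integral {0..x} (?f 0)"
  proof (intro integral_le int)
    fix t assume "t \<in> {0..x}"
    then have "exp (- \<gamma> * t) \<le> 1" using assms by simp
    from mult_right_mono[OF this nonneg[of t]]
    show "?f \<gamma> t \<le> ?f 0 t" by (simp add: mult_ac)
  qed
  then show "bessel_moment \<mu> q \<gamma> x \<le> bessel_moment \<mu> q 0 x"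
    by (simp add: bessel_moment_def)
qed

text \<open>From \<open>2(\<mu> + 2)\<theta>/(1 - \<theta>)\<close> on, the ratio \<open>I\<^sub>\<mu>\<^sub>+\<^sub>2/I\<^sub>\<mu>\<^sub>+\<^sub>1 \<ge> x/(x + 2\<mu> + 4)\<close> is at least \<open>\<theta>\<close>. The
  derivative of the comparison function is therefore, up to the weight \<open>e\<^sup>-\<^sup>\<gamma>\<^sup>x x\<^sup>q\<^sup>-\<^sup>\<mu>\<close>, at least
  \<open>(\<theta> - \<gamma>) I\<^sub>\<mu>\<^sub>+\<^sub>1\<close>, and beyond \<open>X\<close> moreover
  \<open>I\<^sub>\<mu>\<^sub>+\<^sub>1 \<ge> x/(x + 2\<mu> + 2) I\<^sub>\<mu> \<ge> X/(X + 2\<mu> + 2) I\<^sub>\<mu>\<close>.\<close>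
lemma bessel_entire_le_majorant_deriv:
  assumes "\<mu> > -1" "q > -1" "\<gamma> < \<theta>" "\<theta> < 1" "X > 0" "X \<le> x"
    and X: "2 * (\<mu> + 2) * \<theta> / (1 - \<theta>) \<le> X"
    and M: "M \<ge> 1 / (X / (X + 2 * \<mu> + 2) * (\<theta> - \<gamma>))"
  shows "bessel_entire \<mu> ((x / 2)\<^sup>2) \<le> M *
        ((q + 1) / 2 * bessel_entire (\<mu> + 1) ((x / 2)\<^sup>2)
         + (x / 2)\<^sup>2 * bessel_entire (\<mu> + 2) ((x / 2)\<^sup>2)
         - \<gamma> * (x / 2) * bessel_entire (\<mu> + 1) ((x / 2)\<^sup>2))"
proof -
  define s where "s = x / 2"
  define A where "A = bessel_entire \<mu> (s\<^sup>2)"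
  define B where "B = bessel_entire (\<mu> + 1) (s\<^sup>2)"
  define C where "C = bessel_entire (\<mu> + 2) (s\<^sup>2)"
  have s: "s > 0" "X \<le> 2 * s" using assms by (auto simp: s_def)
  have BC: "B > 0" "C > 0" using assms by (auto simp: B_def C_def bessel_entire_pos)
  have M0: "M > 0"
    using M assms by (smt (verit) divide_pos_pos mult_pos_pos)
  have "\<theta> * (s + \<mu> + 2) \<le> s"
  proof -
    have "2 * (\<mu> + 2) * \<theta> \<le> X * (1 - \<theta>)" using X assms by (simp add: pos_divide_le_eq)
    also have "\<dots> \<le> 2 * s * (1 - \<theta>)" using s assms by (intro mult_right_mono) auto
    finally show ?thesis by (simp add: algebra_simps)
  qed
  have "\<theta> * B \<le> s * C"
  proof (cases "\<theta> \<ge> 0")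
    case True
    have "B \<le> (s + \<mu> + 2) * C"
      using bessel_entire_le_next_order[of "\<mu> + 1" s] assms s by (simp add: B_def C_def add.assoc)
    then have "\<theta> * B \<le> (\<theta> * (s + \<mu> + 2)) * C"
      using mult_left_mono[OF _ True] by (simp add: mult.assoc)
    also have "\<dots> \<le> s * C"
      using \<open>\<theta> * (s + \<mu> + 2) \<le> s\<close> BC by (intro mult_right_mono) auto
    finally show ?thesis .
  next
    case False
    then show ?thesis using BC s
      by (smt (verit) mult_pos_pos mult_nonpos_nonneg)
  qed
  have "(s + \<mu> + 1) \<le> M * s * (\<theta> - \<gamma>)"
  proof -
    have "(s + \<mu> + 1) / s \<le> (X + 2 * \<mu> + 2) / X"
    proof -
      have "(2 * \<mu> + 2) / (2 * s) \<le> (2 * \<mu> + 2) / X"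
        using assms s by (intro divide_left_mono) auto
      then show ?thesis using s assms by (simp add: add_divide_distrib)
    qed
    also have "\<dots> \<le> M * (\<theta> - \<gamma>)"
      using M assms by (simp add: divide_simps mult_ac split: if_splits)
    finally show ?thesis using s by (simp add: pos_divide_le_eq mult_ac)
  qed
  then have "(s + \<mu> + 1) * B \<le> M * s * (\<theta> - \<gamma>) * B"
    using BC by (intro mult_right_mono) auto
  moreover have "A \<le> (s + \<mu> + 1) * B"
    using bessel_entire_le_next_order[OF assms(1), of s] s by (simp add: A_def B_def)
  ultimately have "A \<le> M * (s * (\<theta> * B) - \<gamma> * s * B)" by (simp add: algebra_simps)
  also have "\<dots> \<le> M * ((q + 1) / 2 * B + s * (s * C) - \<gamma> * s * B)"
  proof (intro mult_left_mono)
    have "s * (\<theta> * B) \<le> s * (s * C)" using \<open>\<theta> * B \<le> s * C\<close> s by (intro mult_left_mono) auto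
    moreover have "0 \<le> (q + 1) / 2 * B" using assms BC by simp
    ultimately show "s * (\<theta> * B) - \<gamma> * s * B \<le> (q + 1) / 2 * B + s * (s * C) - \<gamma> * s * B"
      by linarith
  qed (use M0 in simp)
  finally show ?thesis
    by (simp add: A_def B_def C_def s_def power2_eq_square mult.assoc)
qed

text \<open>Up to \<open>X\<close> the factor \<open>e\<^sup>\<gamma>\<^sup>x \<le> e\<^sup>\<gamma>\<^sup>X\<close> is all that is lost against the case \<open>\<gamma> = 0\<close>; beyond \<open>X\<close> the
  bound is carried on from \<open>X\<close> by comparing derivatives.\<close>
lemma bessel_moment_upper_bound:
  assumes "\<mu> > -1" "q > -1" "0 \<le> \<gamma>" "\<gamma> < \<theta>" "\<theta> < 1" "x > 0" "X > 0"
    and X: "2 * (\<mu> + 2) * \<theta> / (1 - \<theta>) \<le> X"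
    and M1: "M \<ge> K_const \<mu> q * exp (\<gamma> * X)"
    and M2: "M \<ge> 1 / (X / (X + 2 * \<mu> + 2) * (\<theta> - \<gamma>))"
  shows "bessel_moment \<mu> q \<gamma> x \<le> M * bessel_majorant \<mu> q \<gamma> x"
proof -
  have le: "bessel_moment \<mu> q \<gamma> y \<le> M * bessel_majorant \<mu> q \<gamma> y" if y: "0 < y" "y \<le> X" for y
  proof -
    have K: "K_const \<mu> q \<ge> 0" by (simp add: K_const_def)
    have "bessel_moment \<mu> q \<gamma> y \<le> K_const \<mu> q * bessel_majorant \<mu> q 0 y"
      using bessel_moment_exp_bounds(2)[OF assms(1-3)] bessel_moment_bounds_0(2)[OF assms(1,2) y(1)]
      by (rule order_trans)
    also have "\<dots> = (K_const \<mu> q * exp (\<gamma> * y)) * bessel_majorant \<mu> q \<gamma> y"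
      unfolding bessel_majorant_eq_exp_times[of \<mu> q \<gamma> y] by (simp add: exp_minus)
    also have "\<dots> \<le> (K_const \<mu> q * exp (\<gamma> * X)) * bessel_majorant \<mu> q \<gamma> y"
      using bessel_majorant_pos[OF assms(1) y(1), of q \<gamma>] K assms y
      by (intro mult_right_mono mult_left_mono) (auto intro: mult_left_mono)
    also have "\<dots> \<le> M * bessel_majorant \<mu> q \<gamma> y"
      using bessel_majorant_pos[OF assms(1) y(1), of q \<gamma>] M1 by (intro mult_right_mono) auto
    finally show ?thesis .
  qed
  show ?thesis
  proof (cases "x \<le> X")
    case True
    then show ?thesis using le assms by simp
  next
    case False
    have "bessel_moment \<mu> q \<gamma> x - bessel_moment \<mu> q \<gamma> X
        \<le> M * bessel_majorant \<mu> q \<gamma> x - M * bessel_majorant \<mu> q \<gamma> X"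
    proof (rule increment_le_of_deriv_le)
      show "continuous_on {X..x} (bessel_moment \<mu> q \<gamma>)"
        using assms by (intro continuous_on_subset[OF continuous_on_bessel_moment[of _ _ x]]) auto
      show "continuous_on {X..x} (\<lambda>x. M * bessel_majorant \<mu> q \<gamma> x)"
        using assms
        by (intro continuous_intros continuous_on_subset[OF continuous_on_bessel_majorant[of _ _ x]]) auto
    next
      fix t assume t: "X < t" "t < x"
      then have t0: "t > 0" using assms by simp
      show "(bessel_moment \<mu> q \<gamma> has_real_derivative
          exp (- \<gamma> * t) * t powr q * bessel_entire \<mu> ((t / 2)\<^sup>2)) (at t)"
        by (rule DERIV_bessel_moment[OF assms(1,2) t0])
      show "((\<lambda>x. M * bessel_majorant \<mu> q \<gamma> x) has_real_derivative M *
          (exp (- \<gamma> * t) * t powr q *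
            ((q + 1) / 2 * bessel_entire (\<mu> + 1) ((t / 2)\<^sup>2)
             + (t / 2)\<^sup>2 * bessel_entire (\<mu> + 2) ((t / 2)\<^sup>2)
             - \<gamma> * (t / 2) * bessel_entire (\<mu> + 1) ((t / 2)\<^sup>2)))) (at t)"
        by (rule DERIV_cmult[OF DERIV_bessel_majorant[OF assms(1) t0]])
      show "exp (- \<gamma> * t) * t powr q * bessel_entire \<mu> ((t / 2)\<^sup>2) \<le> M *
          (exp (- \<gamma> * t) * t powr q *
            ((q + 1) / 2 * bessel_entire (\<mu> + 1) ((t / 2)\<^sup>2)
             + (t / 2)\<^sup>2 * bessel_entire (\<mu> + 2) ((t / 2)\<^sup>2)
             - \<gamma> * (t / 2) * bessel_entire (\<mu> + 1) ((t / 2)\<^sup>2)))"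
        unfolding mult.left_commute[of M "exp (- \<gamma> * t) * t powr q"]
        using bessel_entire_le_majorant_deriv[OF assms(1,2,4,5,7) _ X M2, of t] t
        by (intro mult_left_mono) auto
    qed (use False in simp)
    then show ?thesis using le[of X] assms by simp
  qed
qed

section \<open>Bounds and best constants\<close>

theorem corollary4p3:
  fixes \<mu> q :: real
  assumes "\<mu> > -1" and "q > -1"
  shows "(\<forall>\<gamma> \<theta> x :: real. 0 < \<gamma> \<and> \<gamma> < 1 \<and> \<gamma> < \<theta> \<and> \<theta> < 1 \<and> x > 0 \<longrightarrow>
            L_const \<mu> q
              \<le> integral {0..x} (\<lambda>t. exp (- \<gamma> * t) * t powr (q - \<mu>) * bessel_I \<mu> t)
                  / (exp (- \<gamma> * x) * x powr (q - \<mu>) * bessel_I (\<mu> + 1) x) \<and>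
            integral {0..x} (\<lambda>t. exp (- \<gamma> * t) * t powr (q - \<mu>) * bessel_I \<mu> t)
                  / (exp (- \<gamma> * x) * x powr (q - \<mu>) * bessel_I (\<mu> + 1) x)
              \<le> M_const \<mu> q \<gamma> \<theta>) \<and>
         best_upper_const
           (\<lambda>x. integral {0..x} (\<lambda>t. t powr (q - \<mu>) * bessel_I \<mu> t)
                  / (x powr (q - \<mu>) * bessel_I (\<mu> + 1) x)) (K_const \<mu> q) \<and>
         best_lower_const
           (\<lambda>x. integral {0..x} (\<lambda>t. t powr (q - \<mu>) * bessel_I \<mu> t)
                  / (x powr (q - \<mu>) * bessel_I (\<mu> + 1) x)) (L_const \<mu> q)"
proof (intro conjI allI impI; (elim conjE)?)
  fix \<gamma> \<theta> x :: real
  assume g: "0 < \<gamma>" "\<gamma> < 1" "\<gamma> < \<theta>" "\<theta> < 1" "0 < x"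
  define X where "X = X_const \<mu> q \<theta>"
  let ?m = "bessel_majorant \<mu> q \<gamma> x"
  have pos: "?m > 0" by (rule bessel_majorant_pos[OF assms(1) g(5)])
  have X: "2 * (\<mu> + 2) * \<theta> / (1 - \<theta>) \<le> X" by (simp add: X_def X_const_def)
  moreover have "2 * (\<mu> + 2) * \<theta> / (1 - \<theta>) > 0" using assms g by simp
  ultimately have "X > 0" by linarith
  then have "bessel_moment \<mu> q \<gamma> x \<le> M_const \<mu> q \<gamma> \<theta> * ?m"
    using g X by (intro bessel_moment_upper_bound[of _ _ _ \<theta> _ X] assms)
      (auto simp: M_const_def \<beta>_const_def X_def)
  then show "integral {0..x} (\<lambda>t. exp (- \<gamma> * t) * t powr (q - \<mu>) * bessel_I \<mu> t)
      / (exp (- \<gamma> * x) * x powr (q - \<mu>) * bessel_I (\<mu> + 1) x) \<le> M_const \<mu> q \<gamma> \<theta>"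
    unfolding bessel_quotient_eq[OF assms(1) g(5)] by (simp only: pos_divide_le_eq[OF pos])
  have "L_const \<mu> q * ?m = exp (- \<gamma> * x) * (L_const \<mu> q * bessel_majorant \<mu> q 0 x)"
    unfolding bessel_majorant_eq_exp_times[of \<mu> q \<gamma> x] by simp
  also have "\<dots> \<le> exp (- \<gamma> * x) * bessel_moment \<mu> q 0 x"
    by (intro mult_left_mono bessel_moment_bounds_0 assms g) simp
  also have "\<dots> \<le> bessel_moment \<mu> q \<gamma> x"
    using g by (intro bessel_moment_exp_bounds assms) simp
  finally show "L_const \<mu> q \<le> integral {0..x} (\<lambda>t. exp (- \<gamma> * t) * t powr (q - \<mu>) * bessel_I \<mu> t)
      / (exp (- \<gamma> * x) * x powr (q - \<mu>) * bessel_I (\<mu> + 1) x)"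
    unfolding bessel_quotient_eq[OF assms(1) g(5)] by (simp only: pos_le_divide_eq[OF pos])
next
  let ?Q = "\<lambda>x. integral {0..x} (\<lambda>t. t powr (q - \<mu>) * bessel_I \<mu> t)
                  / (x powr (q - \<mu>) * bessel_I (\<mu> + 1) x)"
  have eq: "?Q x = bessel_moment \<mu> q 0 x / bessel_majorant \<mu> q 0 x" if "x > 0" for x
    using bessel_quotient_eq[OF assms(1) that, of 0 q] by simp
  show "best_upper_const ?Q (K_const \<mu> q)"
    using bessel_quotient_best_constants(1)[OF assms] by (simp add: best_upper_const_def eq)
  show "best_lower_const ?Q (L_const \<mu> q)"
    using bessel_quotient_best_constants(2)[OF assms] by (simp add: best_lower_const_def eq)
qed

end
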